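(* Let $F_2$ be the free group of rank $2$. The smallest nontrivial action of $\operatorname{SAut}(F_2)$ is on a set of two elements; that is, there is a nontrivial action of $\operatorname{SAut}(F_2)$ on a set with exactly two elements, and every action of $\operatorname{SAut}(F_2)$ on a set with fewer than two elements is trivial.
   Context: $\operatorname{SAut}(F_n)$ denotes the kernel of the composition $\operatorname{Aut}(F_n) \to \operatorname{GL}_n(\mathbb{Z}) \xrightarrow{\det} \{\pm 1\}$, where the first map is induced by abelianizing $F_n$. An action of a group $G$ on a set $X$ is trivial if the corresponding homomorphism $G \to \operatorname{Sym}(X)$ is trivial. *)

theory Defs
  imports
    "HOL-Algebra.Bij"
    "HOL-Algebra.Group_Action"
    "HOL-Algebra.Generated_Groups"
    "HOL-Algebra.Elementary_Groups"
    "HOL-Algebra.IntRing"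
    "Jordan_Normal_Form.Determinant"
begin

section \<open>Free groups\<close>

text \<open>The letter \<open>(x, True)\<close> stands for the generator \<open>x\<close> and \<open>(x, False)\<close> for its inverse.
  Elements of the free group are the freely reduced words.\<close>

type_synonym 'a letter = "'a \<times> bool"

definition inv_letter :: "'a letter \<Rightarrow> 'a letter" where
  "inv_letter a = (fst a, \<not> snd a)"

definition reduced :: "'a letter list \<Rightarrow> bool" where
  "reduced w \<longleftrightarrow> successively (\<lambda>a b. b \<noteq> inv_letter a) w"

fun push :: "'a letter \<Rightarrow> 'a letter list \<Rightarrow> 'a letter list" where
  "push a [] = [a]"
| "push a (b # w) = (if b = inv_letter a then w else a # b # w)"

definition reduce :: "'a letter list \<Rightarrow> 'a letter list" where
  "reduce w = foldr push w []"

definition free_group :: "'a set \<Rightarrow> 'a letter list monoid" where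
  "free_group X = \<lparr>carrier = {w. reduced w \<and> fst ` set w \<subseteq> X},
     monoid.mult = (\<lambda>v w. reduce (v @ w)), one = []\<rparr>"

definition free_gen :: "'a \<Rightarrow> 'a letter list" where
  "free_gen x = [(x, True)]"

lemma inv_letter_inv_letter [simp]: "inv_letter (inv_letter a) = a"
  by (simp add: inv_letter_def)

lemma fst_inv_letter [simp]: "fst (inv_letter a) = fst a"
  by (simp add: inv_letter_def)

lemma inv_letter_neq [simp]: "inv_letter a \<noteq> a" "a \<noteq> inv_letter a"
  by (auto simp: inv_letter_def prod_eq_iff)

lemma reduced_Nil [simp]: "reduced []"
  by (simp add: reduced_def)

lemma reduced_Cons: "reduced (a # w) \<longleftrightarrow> reduced w \<and> (w = [] \<or> hd w \<noteq> inv_letter a)"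
  by (cases w) (auto simp: reduced_def)

lemma reduced_push: "reduced w \<Longrightarrow> reduced (push a w)"
  by (cases w) (auto simp: reduced_Cons)

lemma push_inv_push: "reduced w \<Longrightarrow> push (inv_letter a) (push a w) = w"
  by (cases w; cases "tl w") (auto simp: reduced_Cons)

lemma set_push: "set (push a w) \<subseteq> insert a (set w)"
  by (cases w) auto

lemma reduced_foldr_push: "reduced w \<Longrightarrow> reduced (foldr push v w)"
  by (induction v) (auto intro: reduced_push)

lemma set_foldr_push: "set (foldr push v w) \<subseteq> set v \<union> set w"
proof (induction v)
  case (Cons a v)
  then show ?case using set_push[of a "foldr push v w"] by auto
qed simp

lemma reduced_reduce: "reduced (reduce w)"
  by (simp add: reduce_def reduced_foldr_push)

lemma set_reduce: "set (reduce w) \<subseteq> set w"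
  using set_foldr_push[of w "[]"] by (simp add: reduce_def)

lemma reduce_id: "reduced w \<Longrightarrow> reduce w = w"
proof (induction w)
  case (Cons a w)
  then have "reduce (a # w) = push a w"
    by (simp add: reduce_def reduced_Cons)
  with Cons.prems show ?case by (cases w) (auto simp: reduced_Cons)
qed (simp add: reduce_def)

lemma reduce_append: "reduced w \<Longrightarrow> reduce (v @ w) = foldr push v w"
  using reduce_id[of w] by (simp add: reduce_def)

lemma foldr_push_push: "reduced w \<Longrightarrow> foldr push (push a v) w = push a (foldr push v w)"
proof (cases v)
  case (Cons b v')
  assume "reduced w"
  then have "reduced (foldr push v' w)" by (rule reduced_foldr_push)
  then show ?thesis
    using Cons push_inv_push[of "foldr push v' w" "inv_letter a"] by auto
qed simp

lemma foldr_push_foldr_push: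
  "reduced w \<Longrightarrow> foldr push (foldr push u v) w = foldr push u (foldr push v w)"
  by (induction u) (auto simp: foldr_push_push)

lemma foldr_push_inv: "reduced w \<Longrightarrow> foldr push (rev (map inv_letter v)) (foldr push v w) = w"
  by (induction v arbitrary: w) (auto simp: push_inv_push reduced_foldr_push)

lemma carrier_free_group:
  "w \<in> carrier (free_group X) \<longleftrightarrow> reduced w \<and> fst ` set w \<subseteq> X"
  by (simp add: free_group_def)

lemma mult_free_group:
  "w \<in> carrier (free_group X) \<Longrightarrow> v \<otimes>\<^bsub>free_group X\<^esub> w = foldr push v w"
  by (simp add: free_group_def reduce_append)

lemma one_free_group: "\<one>\<^bsub>free_group X\<^esub> = []"
  by (simp add: free_group_def)

lemma free_gen_closed: "x \<in> X \<Longrightarrow> free_gen x \<in> carrier (free_group X)"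
  by (simp add: carrier_free_group free_gen_def reduced_Cons)

lemma mult_free_group_closed:
  assumes "v \<in> carrier (free_group X)" "w \<in> carrier (free_group X)"
  shows "v \<otimes>\<^bsub>free_group X\<^esub> w \<in> carrier (free_group X)"
proof -
  have "fst ` set (reduce (v @ w)) \<subseteq> X"
    using assms set_reduce[of "v @ w"] by (fastforce simp: carrier_free_group)
  then show ?thesis
    by (simp add: free_group_def reduced_reduce)
qed

theorem group_free_group: "group (free_group X)"
proof (rule groupI)
  fix u v w
  assume u: "u \<in> carrier (free_group X)" and v: "v \<in> carrier (free_group X)"
    and w: "w \<in> carrier (free_group X)"
  have "reduced w" using w by (simp add: carrier_free_group)
  then show "u \<otimes>\<^bsub>free_group X\<^esub> v \<otimes>\<^bsub>free_group X\<^esub> w =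
      u \<otimes>\<^bsub>free_group X\<^esub> (v \<otimes>\<^bsub>free_group X\<^esub> w)"
    using v w mult_free_group_closed[OF v w]
    by (simp add: mult_free_group foldr_push_foldr_push)
next
  fix w assume w: "w \<in> carrier (free_group X)"
  let ?v = "reduce (rev (map inv_letter w))"
  have "fst ` set ?v \<subseteq> X"
    using image_mono[OF set_reduce[of "rev (map inv_letter w)"], of fst] w
    by (auto simp: carrier_free_group image_image)
  then have "?v \<in> carrier (free_group X)"
    by (simp add: carrier_free_group reduced_reduce)
  moreover have "?v \<otimes>\<^bsub>free_group X\<^esub> w = \<one>\<^bsub>free_group X\<^esub>"
  proof -
    have "?v \<otimes>\<^bsub>free_group X\<^esub> w = foldr push (rev (map inv_letter w)) w"
      using w by (simp add: mult_free_group reduce_def carrier_free_group foldr_push_foldr_push)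
    also have "foldr push w [] = w"
      using w reduce_id[of w] by (simp add: reduce_def carrier_free_group)
    then have "foldr push (rev (map inv_letter w)) w = []"
      using foldr_push_inv[of "[]" w] by simp
    finally show ?thesis by (simp add: one_free_group)
  qed
  ultimately show "\<exists>v\<in>carrier (free_group X). v \<otimes>\<^bsub>free_group X\<^esub> w = \<one>\<^bsub>free_group X\<^esub>"
    by blast
next
  fix w assume "w \<in> carrier (free_group X)"
  then show "\<one>\<^bsub>free_group X\<^esub> \<otimes>\<^bsub>free_group X\<^esub> w = w"
    by (simp add: mult_free_group one_free_group)
next
  show "\<one>\<^bsub>free_group X\<^esub> \<in> carrier (free_group X)"
    by (simp add: carrier_free_group one_free_group)
qed (rule mult_free_group_closed)


section \<open>Abelianization and the group \<open>SAut(F_n)\<close>\<close>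

definition abelianization :: "('a, 'b) monoid_scheme \<Rightarrow> 'a set monoid" where
  "abelianization G = G Mod derived G (carrier G)"

definition ab_class :: "('a, 'b) monoid_scheme \<Rightarrow> 'a \<Rightarrow> 'a set" where
  "ab_class G x = derived G (carrier G) #>\<^bsub>G\<^esub> x"

text \<open>The map induced by an endomorphism acts on a coset by taking its image.
  For an automorphism this image is again a coset.\<close>

definition ab_map :: "('a, 'b) monoid_scheme \<Rightarrow> ('a \<Rightarrow> 'a) \<Rightarrow> 'a set \<Rightarrow> 'a set" where
  "ab_map G \<phi> = (\<lambda>C\<in>carrier (abelianization G). \<phi> ` C)"

abbreviation F :: "nat \<Rightarrow> nat letter list monoid" where
  "F n \<equiv> free_group {..<n}"

text \<open>Column \<open>j\<close> of the matrix holds the coordinates of the image of the \<open>j\<close>-th generator of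
  the abelianized free group with respect to the basis given by the classes of the generators.\<close>

definition is_ab_matrix :: "nat \<Rightarrow> (nat letter list \<Rightarrow> nat letter list) \<Rightarrow> int mat \<Rightarrow> bool" where
  "is_ab_matrix n \<phi> A \<longleftrightarrow> A \<in> carrier_mat n n \<and>
     (\<forall>j<n. ab_map (F n) \<phi> (ab_class (F n) (free_gen j)) =
        (\<Otimes>\<^bsub>abelianization (F n)\<^esub>i\<in>{..<n}.
           ab_class (F n) (free_gen i) [^]\<^bsub>abelianization (F n)\<^esub> (A $$ (i, j))))"

definition ab_matrix :: "nat \<Rightarrow> (nat letter list \<Rightarrow> nat letter list) \<Rightarrow> int mat" where
  "ab_matrix n \<phi> = (THE A. is_ab_matrix n \<phi> A)"

abbreviation GL :: "nat \<Rightarrow> int mat monoid" where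
  "GL n \<equiv> units_of (ring_mat TYPE(int) n ())"

definition SAut :: "nat \<Rightarrow> (nat letter list \<Rightarrow> nat letter list) monoid" where
  "SAut n = (AutoGroup (F n))
     \<lparr>carrier := kernel (AutoGroup (F n)) (units_of \<Z>) (\<lambda>\<phi>. det (ab_matrix n \<phi>))\<rparr>"

definition trivial_action :: "('g, 'm) monoid_scheme \<Rightarrow> 'x set \<Rightarrow> ('g \<Rightarrow> 'x \<Rightarrow> 'x) \<Rightarrow> bool" where
  "trivial_action G X \<phi> \<longleftrightarrow> (\<forall>g\<in>carrier G. \<phi> g = \<one>\<^bsub>BijGroup X\<^esub>)"

section \<open>Well-definedness\<close>

text \<open>Exponent sums give the coordinates on the abelianization of the free group. They show that
  the matrix specified by \<open>is_ab_matrix\<close> exists and is unique.\<close>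

definition expsum :: "'a \<Rightarrow> 'a letter list \<Rightarrow> int" where
  "expsum i w = (\<Sum>a\<leftarrow>w. if fst a = i then (if snd a then 1 else -1) else 0)"

lemma expsum_Nil [simp]: "expsum i [] = 0"
  by (simp add: expsum_def)

lemma expsum_Cons: "expsum i (a # w) = expsum i [a] + expsum i w"
  by (simp add: expsum_def)

lemma expsum_free_gen: "expsum i (free_gen j) = (if i = j then 1 else 0)"
  by (simp add: expsum_def free_gen_def)

lemma expsum_push: "expsum i (push a w) = expsum i [a] + expsum i w"
  by (cases w) (auto simp: expsum_def inv_letter_def)

lemma expsum_foldr_push: "expsum i (foldr push v w) = expsum i v + expsum i w"
proof (induction v)
  case (Cons a v)
  then show ?case using expsum_Cons[of i a v] by (simp add: expsum_push)
qed simp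

lemma expsum_mult:
  "w \<in> carrier (free_group X) \<Longrightarrow> expsum i (v \<otimes>\<^bsub>free_group X\<^esub> w) = expsum i v + expsum i w"
  by (simp add: mult_free_group expsum_foldr_push)

lemma group_hom_expsum: "group_hom (free_group X) integer_group (expsum i)"
  by (intro group_hom.intro group_hom_axioms.intro group_free_group homI)
     (auto simp: expsum_mult)

lemma expsum_derived:
  assumes "w \<in> derived (free_group X) (carrier (free_group X))"
  shows "expsum i w = 0"
proof -
  interpret h: group_hom "free_group X" integer_group "expsum i" by (rule group_hom_expsum)
  have "derived integer_group (expsum i ` carrier (free_group X)) = {0}"
    using comm_group.derived_eq_singleton[OF abelian_integer_group] by simp
  then show ?thesis using h.derived_img[of "carrier (free_group X)"] assms by auto
qed

lemma ab_class_group_hom: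
  assumes "group G" shows "group_hom G (abelianization G) (ab_class G)"
proof -
  interpret group G by fact
  show ?thesis
    unfolding abelianization_def ab_class_def[abs_def]
    by (intro group_hom.intro group_hom_axioms.intro assms derived_quot_is_group
        normal.r_coset_hom_Mod derived_self_is_normal)
qed

lemma comm_group_abelianization: "group G \<Longrightarrow> comm_group (abelianization G)"
  unfolding abelianization_def by (rule group.derived_quot_is_comm_group)

lemma ab_class_eqD:
  assumes "u \<in> carrier (free_group X)" "v \<in> carrier (free_group X)"
    and eq: "ab_class (free_group X) u = ab_class (free_group X) v"
  shows "expsum i u = expsum i v"
proof -
  let ?G = "free_group X"
  interpret group ?G by (rule group_free_group)
  interpret D: normal "derived ?G (carrier ?G)" ?G by (rule derived_self_is_normal)
  have "u \<in> ab_class ?G u"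
    using rcos_self[OF assms(1) D.subgroup_axioms] by (simp add: ab_class_def)
  then obtain d where "d \<in> derived ?G (carrier ?G)" "u = d \<otimes>\<^bsub>?G\<^esub> v"
    unfolding eq by (auto simp: ab_class_def r_coset_def)
  then show ?thesis using assms(2) by (simp add: expsum_mult expsum_derived)
qed

lemma ab_map_ab_class:
  assumes "group G" "\<phi> \<in> auto G" "x \<in> carrier G"
  shows "ab_map G \<phi> (ab_class G x) = ab_class G (\<phi> x)"
proof -
  interpret c: group_hom G "abelianization G" "ab_class G" by (rule ab_class_group_hom) fact
  interpret h: group_hom G G \<phi>
    using assms by (auto simp: auto_def intro!: group_hom.intro group_hom_axioms.intro)
  let ?N = "derived G (carrier G)"
  have "\<phi> ` carrier G = carrier G"
    using assms(2) by (auto simp: auto_def Bij_def bij_betw_def)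
  then have N: "\<phi> ` ?N = ?N" using h.derived_img[of "carrier G"] by simp
  have sub: "?N \<subseteq> carrier G" by (simp add: c.G.derived_in_carrier)
  have "\<phi> ` (?N #>\<^bsub>G\<^esub> x) = (\<phi> ` ?N) #>\<^bsub>G\<^esub> \<phi> x"
    using sub assms(3) by (force simp: r_coset_def subset_iff image_iff)
  then show ?thesis
    using assms(3) c.hom_closed[of x] by (simp add: ab_map_def ab_class_def N)
qed

lemma ab_class_coords:
  assumes "w \<in> carrier (F n)"
  shows "ab_class (F n) w = (\<Otimes>\<^bsub>abelianization (F n)\<^esub>i\<in>{..<n}.
           ab_class (F n) (free_gen i) [^]\<^bsub>abelianization (F n)\<^esub> expsum i w)"
proof -
  let ?A = "abelianization (F n)" and ?c = "ab_class (F n)"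
  interpret c: group_hom "F n" ?A ?c by (rule ab_class_group_hom[OF group_free_group])
  interpret A: comm_group ?A by (rule comm_group_abelianization[OF group_free_group])
  have g [simp]: "?c (free_gen i) \<in> carrier ?A" if "i < n" for i
    using that by (intro c.hom_closed free_gen_closed) simp
  show ?thesis using assms
  proof (induction w)
    case Nil
    have "?c [] = \<one>\<^bsub>?A\<^esub>" using c.hom_one by (simp add: one_free_group)
    then show ?case by simp
  next
    case (Cons a w)
    obtain j b where a: "a = (j, b)" by (cases a)
    have w: "w \<in> carrier (F n)" and j: "j < n" and aF: "[a] \<in> carrier (F n)"
      using Cons.prems by (auto simp: carrier_free_group reduced_Cons a)
    have aw: "a # w = [a] \<otimes>\<^bsub>F n\<^esub> w"
    proof -
      have "reduced (a # w)" using Cons.prems by (simp add: carrier_free_group)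
      then show ?thesis using w by (cases w) (auto simp: mult_free_group reduced_Cons)
    qed
    have ca: "?c [a] = ?c (free_gen j) [^]\<^bsub>?A\<^esub> expsum j [a]"
    proof (cases b)
      case True
      then show ?thesis using j by (simp add: a free_gen_def[symmetric] expsum_free_gen)
    next
      case False
      have "[a] \<otimes>\<^bsub>F n\<^esub> free_gen j = \<one>\<^bsub>F n\<^esub>"
        using False j by (simp add: mult_free_group free_gen_closed one_free_group)
          (simp add: free_gen_def a inv_letter_def)
      then have "[a] = inv\<^bsub>F n\<^esub> (free_gen j)"
        using c.G.inv_equality[OF _ free_gen_closed aF] j by simp
      moreover have "expsum j [a] = - 1" using False by (simp add: expsum_def a)
      ultimately show ?thesis using j
        by (simp add: free_gen_closed c.H.int_pow_neg)
    qed
    have e: "i \<noteq> j \<Longrightarrow> expsum i [a] = 0" for i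
      by (simp add: expsum_def a)
    have "?c [a] = (\<Otimes>\<^bsub>?A\<^esub>i\<in>{..<n}. if j = i then ?c (free_gen i) [^]\<^bsub>?A\<^esub> expsum i [a] else \<one>\<^bsub>?A\<^esub>)"
      using j by (subst A.finprod_singleton) (auto simp: ca)
    also have "\<dots> = (\<Otimes>\<^bsub>?A\<^esub>i\<in>{..<n}. ?c (free_gen i) [^]\<^bsub>?A\<^esub> expsum i [a])"
      by (intro A.finprod_cong') (auto simp: e)
    finally have "?c (a # w) = (\<Otimes>\<^bsub>?A\<^esub>i\<in>{..<n}. ?c (free_gen i) [^]\<^bsub>?A\<^esub> expsum i [a])
        \<otimes>\<^bsub>?A\<^esub> (\<Otimes>\<^bsub>?A\<^esub>i\<in>{..<n}. ?c (free_gen i) [^]\<^bsub>?A\<^esub> expsum i w)"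
      using Cons.IH[OF w] w aF by (simp add: aw)
    also have "\<dots> = (\<Otimes>\<^bsub>?A\<^esub>i\<in>{..<n}. ?c (free_gen i) [^]\<^bsub>?A\<^esub> expsum i [a]
        \<otimes>\<^bsub>?A\<^esub> ?c (free_gen i) [^]\<^bsub>?A\<^esub> expsum i w)"
      by (subst A.finprod_multf) auto
    also have "\<dots> = (\<Otimes>\<^bsub>?A\<^esub>i\<in>{..<n}. ?c (free_gen i) [^]\<^bsub>?A\<^esub> expsum i (a # w))"
      by (intro A.finprod_cong') (auto simp: c.H.int_pow_mult expsum_Cons[of _ a w])
    finally show ?case .
  qed
qed

lemma ex_word_of_coords:
  assumes "m \<le> n"
  shows "\<exists>w\<in>carrier (F n). ab_class (F n) w = (\<Otimes>\<^bsub>abelianization (F n)\<^esub>i\<in>{..<m}.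
           ab_class (F n) (free_gen i) [^]\<^bsub>abelianization (F n)\<^esub> (a i :: int)) \<and>
           (\<forall>i. expsum i w = (if i < m then a i else 0))"
proof -
  let ?A = "abelianization (F n)" and ?c = "ab_class (F n)"
  interpret c: group_hom "F n" ?A ?c by (rule ab_class_group_hom[OF group_free_group])
  interpret A: comm_group ?A by (rule comm_group_abelianization[OF group_free_group])
  have g [simp]: "?c (free_gen i) \<in> carrier ?A" if "i < n" for i
    using that by (intro c.hom_closed free_gen_closed) simp
  show ?thesis using assms
  proof (induction m)
    case 0
    have "?c [] = \<one>\<^bsub>?A\<^esub>" using c.hom_one by (simp add: one_free_group)
    then show ?case by (intro bexI[of _ "[]"]) (auto simp: carrier_free_group)
  next
    case (Suc m)
    then obtain w where w: "w \<in> carrier (F n)"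
      "?c w = (\<Otimes>\<^bsub>?A\<^esub>i\<in>{..<m}. ?c (free_gen i) [^]\<^bsub>?A\<^esub> a i)"
      "\<And>i. expsum i w = (if i < m then a i else 0)" by auto
    let ?p = "free_gen m [^]\<^bsub>F n\<^esub> a m"
    have m: "free_gen m \<in> carrier (F n)" using Suc.prems by (intro free_gen_closed) simp
    have e: "expsum i ?p = (if i = m then a m else 0)" for i
      using group_hom.hom_int_pow[OF group_hom_expsum m, of i "a m"]
      by (simp add: expsum_free_gen)
    have "(\<Otimes>\<^bsub>?A\<^esub>i\<in>{..<Suc m}. ?c (free_gen i) [^]\<^bsub>?A\<^esub> a i) = ?c (?p \<otimes>\<^bsub>F n\<^esub> w)"
      using Suc.prems m w(1) w(2)
      by (simp add: lessThan_Suc c.hom_int_pow A.finprod_insert Pi_def)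
    moreover have "expsum i (?p \<otimes>\<^bsub>F n\<^esub> w) = (if i < Suc m then a i else 0)" for i
      using w(1) by (cases "i = m") (auto simp: expsum_mult e w(3))
    ultimately show ?case
      using m w(1) by (intro bexI[of _ "?p \<otimes>\<^bsub>F n\<^esub> w"]) auto
  qed
qed

theorem is_ab_matrix_iff:
  assumes "\<phi> \<in> auto (F n)"
  shows "is_ab_matrix n \<phi> A \<longleftrightarrow> A = mat n n (\<lambda>(i, j). expsum i (\<phi> (free_gen j)))"
proof -
  have \<phi>: "\<phi> (free_gen j) \<in> carrier (F n)" if "j < n" for j
    using assms free_gen_closed[of j "{..<n}"] that by (auto simp: auto_def hom_def)
  have m: "ab_map (F n) \<phi> (ab_class (F n) (free_gen j)) = ab_class (F n) (\<phi> (free_gen j))"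
    if "j < n" for j
    using that by (intro ab_map_ab_class group_free_group assms free_gen_closed) simp
  show ?thesis
  proof
    assume eq: "A = mat n n (\<lambda>(i, j). expsum i (\<phi> (free_gen j)))"
    interpret A: comm_group "abelianization (F n)"
      by (rule comm_group_abelianization[OF group_free_group])
    interpret c: group_hom "F n" "abelianization (F n)" "ab_class (F n)"
      by (rule ab_class_group_hom[OF group_free_group])
    have "ab_class (F n) (\<phi> (free_gen j)) = (\<Otimes>\<^bsub>abelianization (F n)\<^esub>i\<in>{..<n}.
        ab_class (F n) (free_gen i) [^]\<^bsub>abelianization (F n)\<^esub> (A $$ (i, j)))" if "j < n" for j
      unfolding ab_class_coords[OF \<phi>[OF that]]
      using that by (intro A.finprod_cong') (auto simp: eq free_gen_closed)
    then show "is_ab_matrix n \<phi> A"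
      by (simp add: is_ab_matrix_def m) (simp add: eq)
  next
    assume A: "is_ab_matrix n \<phi> A"
    show "A = mat n n (\<lambda>(i, j). expsum i (\<phi> (free_gen j)))"
    proof (rule eq_matI)
      fix i j
      assume "i < dim_row (mat n n (\<lambda>(i, j). expsum i (\<phi> (free_gen j))))"
        "j < dim_col (mat n n (\<lambda>(i, j). expsum i (\<phi> (free_gen j))))"
      then have i: "i < n" and j: "j < n" by auto
      obtain w where w: "w \<in> carrier (F n)"
        "ab_class (F n) w = (\<Otimes>\<^bsub>abelianization (F n)\<^esub>i\<in>{..<n}.
           ab_class (F n) (free_gen i) [^]\<^bsub>abelianization (F n)\<^esub> (A $$ (i, j)))"
        "\<And>i. expsum i w = (if i < n then A $$ (i, j) else 0)"
        using ex_word_of_coords[OF order_refl, of n "\<lambda>i. A $$ (i, j)"] by auto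
      have "ab_class (F n) w = ab_class (F n) (\<phi> (free_gen j))"
        using A j m[OF j] w(2) by (simp add: is_ab_matrix_def)
      from ab_class_eqD[OF w(1) \<phi>[OF j] this, of i]
      show "A $$ (i, j) = mat n n (\<lambda>(i, j). expsum i (\<phi> (free_gen j))) $$ (i, j)"
        using i j w(3)[of i] by simp
    qed (use A in \<open>auto simp: is_ab_matrix_def\<close>)
  qed
qed

corollary ab_matrix_eq:
  assumes "\<phi> \<in> auto (F n)"
  shows "ab_matrix n \<phi> = mat n n (\<lambda>(i, j). expsum i (\<phi> (free_gen j)))"
  using is_ab_matrix_iff[OF assms] by (simp add: ab_matrix_def)

lemma expsum_auto:
  assumes "\<phi> \<in> auto (F n)" "w \<in> carrier (F n)"
  shows "expsum i (\<phi> w) = (\<Sum>k<n. expsum i (\<phi> (free_gen k)) * expsum k w)"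
  using assms(2)
proof (induction w)
  case Nil
  interpret h: group_hom "F n" "F n" \<phi>
    using assms by (auto simp: auto_def group_free_group intro!: group_hom.intro group_hom_axioms.intro)
  show ?case using h.hom_one by (simp add: one_free_group)
next
  case (Cons a w)
  interpret h: group_hom "F n" "F n" \<phi>
    using assms by (auto simp: auto_def group_free_group intro!: group_hom.intro group_hom_axioms.intro)
  obtain j b where a: "a = (j, b)" by (cases a)
  have w: "w \<in> carrier (F n)" and j: "j < n" and aF: "[a] \<in> carrier (F n)"
    using Cons.prems by (auto simp: carrier_free_group reduced_Cons a)
  have jF: "free_gen j \<in> carrier (F n)" using j by (intro free_gen_closed) simp
  have aw: "a # w = [a] \<otimes>\<^bsub>F n\<^esub> w"
  proof -
    have "reduced (a # w)" using Cons.prems by (simp add: carrier_free_group)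
    then show ?thesis using w by (cases w) (auto simp: mult_free_group reduced_Cons)
  qed
  have "expsum i (\<phi> [a]) = expsum i (\<phi> (free_gen j)) * expsum j [a]"
  proof (cases b)
    case True
    then show ?thesis by (simp add: a free_gen_def[symmetric] expsum_free_gen)
  next
    case False
    have "[a] \<otimes>\<^bsub>F n\<^esub> free_gen j = \<one>\<^bsub>F n\<^esub>"
      using False jF by (simp add: mult_free_group one_free_group)
        (simp add: free_gen_def a inv_letter_def)
    then have "\<phi> [a] \<otimes>\<^bsub>F n\<^esub> \<phi> (free_gen j) = \<one>\<^bsub>F n\<^esub>"
      using h.hom_mult[OF aF jF] by simp
    then have "expsum i (\<phi> [a]) + expsum i (\<phi> (free_gen j)) = 0"
      using expsum_mult[OF h.hom_closed[OF jF], of i "\<phi> [a]"] by (simp add: one_free_group)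
    moreover have "expsum j [a] = - 1" using False by (simp add: expsum_def a)
    ultimately show ?thesis by simp
  qed
  moreover have "k \<noteq> j \<Longrightarrow> expsum k [a] = 0" for k
    by (simp add: expsum_def a)
  then have "(\<Sum>k<n. expsum i (\<phi> (free_gen k)) * expsum k [a]) =
      (\<Sum>k<n. if k = j then expsum i (\<phi> (free_gen j)) * expsum j [a] else 0)"
    by (intro sum.cong) auto
  ultimately have "expsum i (\<phi> [a]) = (\<Sum>k<n. expsum i (\<phi> (free_gen k)) * expsum k [a])"
    using j by simp
  moreover have "expsum i (\<phi> (a # w)) = expsum i (\<phi> [a]) + expsum i (\<phi> w)"
    using w aF by (simp add: aw expsum_mult)
  ultimately show ?case
    using Cons.IH[OF w] expsum_Cons[of _ a w] by (simp add: algebra_simps sum.distrib)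
qed

lemma carrier_AutoGroup: "carrier (AutoGroup G) = auto G"
  by (simp add: AutoGroup_def)

lemma one_AutoGroup: "\<one>\<^bsub>AutoGroup G\<^esub> = (\<lambda>x\<in>carrier G. x)"
  by (simp add: AutoGroup_def BijGroup_def)

lemma mult_AutoGroup:
  "\<lbrakk>\<phi> \<in> auto G; \<psi> \<in> auto G\<rbrakk> \<Longrightarrow> \<phi> \<otimes>\<^bsub>AutoGroup G\<^esub> \<psi> = compose (carrier G) \<phi> \<psi>"
  by (simp add: AutoGroup_def BijGroup_def auto_def)

lemma ab_matrix_mult:
  assumes "\<phi> \<in> auto (F n)" "\<psi> \<in> auto (F n)"
  shows "ab_matrix n (\<phi> \<otimes>\<^bsub>AutoGroup (F n)\<^esub> \<psi>) = ab_matrix n \<phi> * ab_matrix n \<psi>"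
proof -
  interpret Aut: group "AutoGroup (F n)" by (rule group.AutoGroup[OF group_free_group])
  have c: "\<phi> \<otimes>\<^bsub>AutoGroup (F n)\<^esub> \<psi> \<in> auto (F n)"
    using Aut.m_closed assms by (simp add: carrier_AutoGroup)
  have "expsum i ((\<phi> \<otimes>\<^bsub>AutoGroup (F n)\<^esub> \<psi>) (free_gen j)) =
      (\<Sum>k<n. expsum i (\<phi> (free_gen k)) * expsum k (\<psi> (free_gen j)))" if "j < n" for i j
  proof -
    have j: "free_gen j \<in> carrier (F n)" using that by (intro free_gen_closed) simp
    then have "\<psi> (free_gen j) \<in> carrier (F n)" using assms(2) by (auto simp: auto_def hom_def)
    then show ?thesis
      using j assms by (simp add: mult_AutoGroup compose_eq expsum_auto)
  qed
  then show ?thesis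
    unfolding ab_matrix_eq[OF c] ab_matrix_eq[OF assms(1)] ab_matrix_eq[OF assms(2)]
    by (intro eq_matI) (auto simp: scalar_prod_def atLeast0LessThan)
qed

lemma ab_matrix_one: "ab_matrix n \<one>\<^bsub>AutoGroup (F n)\<^esub> = 1\<^sub>m n"
proof -
  have "\<one>\<^bsub>AutoGroup (F n)\<^esub> \<in> auto (F n)"
    using group.id_in_auto[OF group_free_group] by (simp add: one_AutoGroup)
  then show ?thesis
    by (auto simp: ab_matrix_eq one_AutoGroup free_gen_closed expsum_free_gen intro!: eq_matI)
qed

lemma ab_matrix_carrier: "\<phi> \<in> auto (F n) \<Longrightarrow> ab_matrix n \<phi> \<in> carrier_mat n n"
  by (simp add: ab_matrix_eq)

theorem ab_matrix_hom: "ab_matrix n \<in> hom (AutoGroup (F n)) (GL n)"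
proof (rule homI)
  interpret Aut: group "AutoGroup (F n)" by (rule group.AutoGroup[OF group_free_group])
  fix \<phi> assume \<phi>: "\<phi> \<in> carrier (AutoGroup (F n))"
  let ?\<psi> = "inv\<^bsub>AutoGroup (F n)\<^esub> \<phi>"
  have \<psi>: "?\<psi> \<in> carrier (AutoGroup (F n))" using \<phi> by simp
  have "ab_matrix n ?\<psi> * ab_matrix n \<phi> = 1\<^sub>m n" "ab_matrix n \<phi> * ab_matrix n ?\<psi> = 1\<^sub>m n"
    using \<phi> \<psi> ab_matrix_mult[of \<phi> n ?\<psi>] ab_matrix_mult[of ?\<psi> n \<phi>]
    by (auto simp flip: carrier_AutoGroup simp: ab_matrix_one)
  then show "ab_matrix n \<phi> \<in> carrier (GL n)"
    using ab_matrix_carrier \<phi> \<psi>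
    by (auto simp: units_of_carrier Units_def ring_mat_simps carrier_AutoGroup)
qed (simp add: units_of_mult ring_mat_simps carrier_AutoGroup ab_matrix_mult)

theorem det_hom: "det \<in> hom (GL n) (units_of \<Z>)"
proof (rule homI)
  fix A assume "A \<in> carrier (GL n)"
  then obtain B where "A \<in> carrier_mat n n" "B \<in> carrier_mat n n"
    "B * A = 1\<^sub>m n" "A * B = 1\<^sub>m n"
    by (auto simp: units_of_carrier Units_def ring_mat_simps)
  then have "det B * det A = 1" "det A * det B = 1"
    by (metis det_mult det_one)+
  then show "det A \<in> carrier (units_of \<Z>)"
    by (auto simp: units_of_carrier Units_def)
next
  fix A B assume "A \<in> carrier (GL n)" "B \<in> carrier (GL n)"
  then show "det (A \<otimes>\<^bsub>GL n\<^esub> B) = det A \<otimes>\<^bsub>units_of \<Z>\<^esub> det B"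
    by (auto simp: units_of_carrier units_of_mult Units_def ring_mat_simps det_mult)
qed

lemma carrier_units_int: "carrier (units_of \<Z>) = {1, -1}"
  by (auto simp: units_of_carrier Units_def zmult_eq_1_iff)

theorem group_hom_det_ab_matrix:
  "group_hom (AutoGroup (F n)) (units_of \<Z>) (\<lambda>\<phi>. det (ab_matrix n \<phi>))"
proof (intro group_hom.intro group_hom_axioms.intro)
  show "group (AutoGroup (F n))" by (rule group.AutoGroup[OF group_free_group])
  show "group (units_of \<Z>)" by (rule int.units_group)
  show "(\<lambda>\<phi>. det (ab_matrix n \<phi>)) \<in> hom (AutoGroup (F n)) (units_of \<Z>)"
    using hom_compose[OF ab_matrix_hom det_hom] by (simp add: comp_def)
qed

theorem group_SAut: "group (SAut n)"
  unfolding SAut_def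
  by (intro subgroup.subgroup_is_group group_hom.subgroup_kernel group_hom_det_ab_matrix
      group.AutoGroup group_free_group)

end

theory Submission
  imports Defs
begin

text \<open>A group with a non-constant homomorphism to \<open>\<int>/2\<close> acts nontrivially on two points. For
  \<open>SAut 2\<close> such a homomorphism is the composition
  \<open>SAut(F\<^sub>2) \<rightarrow> SL\<^sub>2(\<int>) \<rightarrow> SL\<^sub>2(\<int>/2) \<cong> S\<^sub>3 \<rightarrow> {\<plusminus>1}\<close>. It is nontrivial on the automorphism
  \<open>x\<^sub>0 \<mapsto> x\<^sub>1, x\<^sub>1 \<mapsto> x\<^sub>0\<^sup>-\<^sup>1\<close>, which acts on reduced words by permuting the letters.\<close>

text \<open>With at most one point, the only extensional self-map of \<open>X\<close> is the
  restricted identity, so \<open>BijGroup X\<close> has just one element.\<close>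

lemma trivial_action_card_less_2:
  assumes "finite X" "card X < 2" "group_action G X \<phi>"
  shows "trivial_action G X \<phi>"
  unfolding trivial_action_def
proof
  fix g assume "g \<in> carrier G"
  then have "\<phi> g \<in> Bij X"
    using assms(3) by (auto simp: group_action_def group_hom_def group_hom_axioms_def hom_def BijGroup_def)
  then have ext: "\<phi> g \<in> extensional X" and im: "\<And>x. x \<in> X \<Longrightarrow> \<phi> g x \<in> X"
    by (auto simp: Bij_def bij_betw_def)
  have "x = y" if "x \<in> X" "y \<in> X" for x y
    using assms(1,2) that card_le_Suc0_iff_eq[of X] by auto
  then have "\<phi> g = (\<lambda>x\<in>X. x)"
    using ext im by (intro extensionalityI[of _ X]) auto
  then show "\<phi> g = \<one>\<^bsub>BijGroup X\<^esub>" by (simp add: BijGroup_def)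
qed

text \<open>Here \<open>p\<close> encodes a homomorphism to \<int>/2: \<open>True\<close> is the
  neutral element and equality of truth values is the group operation. Elements on which
  \<open>p\<close> fails swap 0 and 1.\<close>

lemma nontrivial_action_of_parity:
  assumes "group G"
    and mult: "\<And>g h. g \<in> carrier G \<Longrightarrow> h \<in> carrier G \<Longrightarrow> p (g \<otimes>\<^bsub>G\<^esub> h) = (p g = p h)"
    and odd: "g \<in> carrier G" "\<not> p g"
  shows "\<exists>(X :: nat set) \<phi>. finite X \<and> card X = 2 \<and>
            group_action G X \<phi> \<and> \<not> trivial_action G X \<phi>"
proof -
  let ?X = "{0, 1::nat}"
  let ?\<phi> = "\<lambda>g. \<lambda>x\<in>?X. if p g then x else 1 - x"
  have bij: "?\<phi> g \<in> Bij ?X" for g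
    by (auto simp: Bij_def bij_betw_def inj_on_def)
  have "?\<phi> \<in> hom G (BijGroup ?X)"
  proof (rule homI)
    fix g h assume "g \<in> carrier G" "h \<in> carrier G"
    then show "?\<phi> (g \<otimes>\<^bsub>G\<^esub> h) = ?\<phi> g \<otimes>\<^bsub>BijGroup ?X\<^esub> ?\<phi> h"
      using bij[of g] bij[of h] by (auto simp: BijGroup_def mult compose_def fun_eq_iff restrict_def)
  qed (use bij in \<open>simp add: BijGroup_def\<close>)
  then have "group_action G ?X ?\<phi>"
    by (intro group_action.intro group_hom.intro group_hom_axioms.intro assms(1) group_BijGroup)
  moreover have "?\<phi> g 0 \<noteq> \<one>\<^bsub>BijGroup ?X\<^esub> 0"
    using odd by (simp add: BijGroup_def)
  then have "\<not> trivial_action G ?X ?\<phi>"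
    using odd(1) unfolding trivial_action_def by metis
  moreover have "finite ?X" "card ?X = 2" by simp_all
  ultimately show ?thesis by (intro exI[of _ ?X] exI[of _ ?\<phi>]) simp
qed

text \<open>On \<open>SL\<^sub>2(\<int>/2)\<close> the polynomial \<open>ab + bc + cd\<close> vanishes exactly at the identity and the two
  elements of order 3, so it is the sign homomorphism of \<open>S\<^sub>3\<close> written additively.\<close>

definition even_mat2 :: "int mat \<Rightarrow> bool" where
  "even_mat2 A \<longleftrightarrow> even (A $$ (0,0) * A $$ (0,1) + A $$ (0,1) * A $$ (1,0) + A $$ (1,0) * A $$ (1,1))"

lemma det_mat2:
  assumes "(A :: 'a :: comm_ring_1 mat) \<in> carrier_mat 2 2"
  shows "det A = A $$ (0,0) * A $$ (1,1) - A $$ (0,1) * A $$ (1,0)"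
  using assms
  by (subst laplace_expansion_column[OF assms, of 0])
     (auto simp: numeral_2_eq_2 cofactor_def mat_delete_def det_single)

lemma even_mat2_mult:
  assumes A: "A \<in> carrier_mat 2 2" "odd (det A)" and B: "B \<in> carrier_mat 2 2" "odd (det B)"
  shows "even_mat2 (A * B) = (even_mat2 A = even_mat2 B)"
proof -
  have "(A * B) $$ (i, j) = A $$ (i,0) * B $$ (0,j) + A $$ (i,1) * B $$ (1,j)" if "i < 2" "j < 2" for i j
    using A(1) B(1) that by (auto simp: scalar_prod_def numeral_2_eq_2)
  then have e: "even_mat2 (A * B) \<longleftrightarrow> even (
      (A $$ (0,0) * B $$ (0,0) + A $$ (0,1) * B $$ (1,0)) * (A $$ (0,0) * B $$ (0,1) + A $$ (0,1) * B $$ (1,1)) +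
      (A $$ (0,0) * B $$ (0,1) + A $$ (0,1) * B $$ (1,1)) * (A $$ (1,0) * B $$ (0,0) + A $$ (1,1) * B $$ (1,0)) +
      (A $$ (1,0) * B $$ (0,0) + A $$ (1,1) * B $$ (1,0)) * (A $$ (1,0) * B $$ (0,1) + A $$ (1,1) * B $$ (1,1)))"
    by (simp add: even_mat2_def)
  \<comment> \<open>Pushing parity through sums and products leaves a propositional statement about
    the parities of the eight entries, which \<open>argo\<close> decides.\<close>
  show ?thesis
    using A(2) B(2) unfolding e
    unfolding det_mat2[OF A(1)] det_mat2[OF B(1)] even_mat2_def even_add even_diff even_mult_iff
    by argo
qed

lemma carrier_SAut: "carrier (SAut n) = {\<phi> \<in> auto (F n). det (ab_matrix n \<phi>) = 1}"
  by (auto simp: SAut_def kernel_def carrier_AutoGroup units_of_one)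

lemma mult_SAut: "\<phi> \<otimes>\<^bsub>SAut n\<^esub> \<psi> = \<phi> \<otimes>\<^bsub>AutoGroup (F n)\<^esub> \<psi>"
  by (simp add: SAut_def)

lemma map_push:
  assumes "inj \<sigma>" "\<And>a. \<sigma> (inv_letter a) = inv_letter (\<sigma> a)"
  shows "map \<sigma> (push a w) = push (\<sigma> a) (map \<sigma> w)"
  using assms by (cases w) (auto simp flip: assms(2) dest: injD)

lemma map_foldr_push:
  assumes "inj \<sigma>" "\<And>a. \<sigma> (inv_letter a) = inv_letter (\<sigma> a)"
  shows "map \<sigma> (foldr push v w) = foldr push (map \<sigma> v) (map \<sigma> w)"
  by (induction v) (simp_all add: map_push[OF assms])

lemma reduced_map:
  assumes "inj \<sigma>" "\<And>a. \<sigma> (inv_letter a) = inv_letter (\<sigma> a)"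
  shows "reduced (map \<sigma> w) = reduced w"
  using assms(1) by (simp add: reduced_def successively_map inj_eq flip: assms(2))

text \<open>A permutation of the letters that commutes with inversion preserves and reflects
  cancellation, so letterwise application keeps words reduced and respects products. The restriction
  supplies the extensionality that \<open>Bij\<close> demands.\<close>

lemma map_in_auto_free_group:
  assumes "bij \<sigma>" and inv: "\<And>a. \<sigma> (inv_letter a) = inv_letter (\<sigma> a)"
    and X: "\<And>a. fst (\<sigma> a) \<in> X \<longleftrightarrow> fst a \<in> X"
  shows "restrict (map \<sigma>) (carrier (free_group X)) \<in> auto (free_group X)"
proof -
  let ?G = "free_group X"
  interpret group ?G by (rule group_free_group)
  have inj: "inj \<sigma>" using assms(1) by (rule bij_is_inj)
  have iff: "map \<sigma> w \<in> carrier ?G \<longleftrightarrow> w \<in> carrier ?G" for w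
    by (auto simp: carrier_free_group reduced_map[OF inj inv] X image_subset_iff)
  have "map \<sigma> ` carrier ?G = carrier ?G"
  proof (intro equalityI subsetI)
    fix w assume w: "w \<in> carrier ?G"
    \<comment> \<open>The preimage is formed letterwise; \<open>iff\<close> puts it back into the
      carrier.\<close>
    have "map \<sigma> (map (inv_into UNIV \<sigma>) w) = w"
      using assms(1) by (simp add: bij_is_surj surj_f_inv_f map_idI)
    with w iff[of "map (inv_into UNIV \<sigma>) w"] show "w \<in> map \<sigma> ` carrier ?G"
      by (intro image_eqI[of _ _ "map (inv_into UNIV \<sigma>) w"]) simp_all
  qed (use iff in auto)
  then have "bij_betw (map \<sigma>) (carrier ?G) (carrier ?G)"
    using inj by (auto simp: bij_betw_def intro: inj_on_subset[OF inj_mapI])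
  then have "restrict (map \<sigma>) (carrier ?G) \<in> Bij (carrier ?G)"
    by (auto simp: Bij_def)
  moreover have "restrict (map \<sigma>) (carrier ?G) \<in> hom ?G ?G"
    using iff m_closed by (auto intro!: homI simp: mult_free_group map_foldr_push[OF inj inv])
  ultimately show ?thesis by (simp add: auto_def)
qed

text \<open>Letters of index at least 2 are fixed, which makes this a bijection of the whole letter
  type.\<close>

definition rot_letter :: "nat letter \<Rightarrow> nat letter" where
  "rot_letter = (\<lambda>(i, b). if i = 0 then (1, b) else if i = 1 then (0, \<not> b) else (i, b))"

definition rot :: "nat letter list \<Rightarrow> nat letter list" where
  "rot = restrict (map rot_letter) (carrier (F 2))"

lemma rot_auto: "rot \<in> auto (F 2)"
  unfolding rot_def
proof (rule map_in_auto_free_group)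
  show "bij rot_letter"
    \<comment> \<open>The fourth power of \<open>rot_letter\<close> is the identity, so its cube is
      the inverse.\<close>
    by (rule o_bij[of "rot_letter \<circ> rot_letter \<circ> rot_letter"])
       (auto simp: rot_letter_def fun_eq_iff)
qed (auto simp: rot_letter_def inv_letter_def split: if_splits)

lemma ab_matrix_rot:
  "ab_matrix 2 rot = mat 2 2 (\<lambda>(i, j). if (i, j) = (0, 1) then -1 else if (i, j) = (1, 0) then 1 else 0)"
proof -
  have "rot (free_gen 0) = [(1, True)]" "rot (free_gen (Suc 0)) = [(0, False)]"
    using free_gen_closed[of 0 "{..<2::nat}"] free_gen_closed[of "Suc 0" "{..<2::nat}"]
    by (auto simp: rot_def rot_letter_def free_gen_def)
  then show ?thesis
    unfolding ab_matrix_eq[OF rot_auto]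
    by (intro eq_matI) (auto simp: expsum_def less_2_cases_iff)
qed

theorem proposition3p2:
  shows "(\<exists>(X :: nat set) \<phi>. finite X \<and> card X = 2 \<and>
            group_action (SAut 2) X \<phi> \<and> \<not> trivial_action (SAut 2) X \<phi>) \<and>
         (\<forall>(X :: 'a set) \<phi>. finite X \<and> card X < 2 \<and>
            group_action (SAut 2) X \<phi> \<longrightarrow> trivial_action (SAut 2) X \<phi>)"
proof
  show "\<exists>(X :: nat set) \<phi>. finite X \<and> card X = 2 \<and>
            group_action (SAut 2) X \<phi> \<and> \<not> trivial_action (SAut 2) X \<phi>"
  proof (rule nontrivial_action_of_parity)
    show "rot \<in> carrier (SAut 2)"
      by (simp add: carrier_SAut rot_auto ab_matrix_rot det_mat2)
    \<comment> \<open>This fixes the parity as \<open>even_mat2\<close> of the abelianized matrix;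
      on \<open>rot\<close> the polynomial takes the odd value -1.\<close>
    show "\<not> even_mat2 (ab_matrix 2 rot)"
      by (simp add: even_mat2_def ab_matrix_rot)
  qed (auto simp: group_SAut carrier_SAut mult_SAut ab_matrix_mult even_mat2_mult ab_matrix_carrier)
qed (auto intro: trivial_action_card_less_2)

end
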